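(* Let $\mathcal{A}$ be a Leibniz algebra over a field $F$ of characteristic zero and let $M$ be a nilpotent subinvariant subalgebra of $\mathcal{A}$. Then $M \subseteq \mathrm{nilrad}(\mathcal{A})$.
   Context: A Leibniz algebra over a field $F$ means a finite-dimensional left Leibniz algebra: a finite-dimensional $F$-vector space with a bilinear product $(x,y)\mapsto xy$ such that $x(yz) = (xy)z + y(xz)$ for all $x,y,z$. Ideals are two-sided; $I \vartriangleleft J$ means $I$ is an ideal of $J$. Set $\mathcal{A}^1 = \mathcal{A}$ and $\mathcal{A}^{i} = \mathcal{A}\mathcal{A}^{i-1}$ (linear span of products) for $i \ge 2$; $\mathcal{A}$ is nilpotent if $\mathcal{A}^m = \{0\}$ for some positive integer $m$. The maximal nilpotent ideal of $\mathcal{A}$ is the nilradical $\mathrm{nilrad}(\mathcal{A})$. A subalgebra $B$ of $\mathcal{A}$ is subinvariant in $\mathcal{A}$ if there is a chain of subalgebras $B = B_t \subset B_{t-1} \subset \cdots \subset B_0 = \mathcal{A}$ with $B_i \vartriangleleft B_{i-1}$ for all $1 \leq i \leq t$. *)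

theory Defs
  imports Complex_Main
begin

text \<open>Finite-dimensional left Leibniz algebras. The algebra is the whole type \<open>'v\<close>;
  subalgebras and ideals are subsets of it.\<close>

locale leibniz_algebra = vector_space scale
  for scale :: "'f::field \<Rightarrow> 'v::ab_group_add \<Rightarrow> 'v" +
  fixes mult :: "'v \<Rightarrow> 'v \<Rightarrow> 'v"
  assumes finite_dim: "\<exists>B. finite B \<and> span B = UNIV"
    and linear_mult_right: "\<And>x. Vector_Spaces.linear scale scale (\<lambda>y. mult x y)"
    and linear_mult_left: "\<And>y. Vector_Spaces.linear scale scale (\<lambda>x. mult x y)"
    and leibniz: "\<And>x y z. mult x (mult y z) = mult (mult x y) z + mult y (mult x z)"
begin

definition subalgebra :: "'v set \<Rightarrow> bool" where
  "subalgebra B \<longleftrightarrow> subspace B \<and> (\<forall>x\<in>B. \<forall>y\<in>B. mult x y \<in> B)"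

definition ideal_of :: "'v set \<Rightarrow> 'v set \<Rightarrow> bool" where
  "ideal_of I J \<longleftrightarrow>
     subspace I \<and> I \<subseteq> J \<and> (\<forall>x\<in>I. \<forall>y\<in>J. mult x y \<in> I \<and> mult y x \<in> I)"

definition set_mult :: "'v set \<Rightarrow> 'v set \<Rightarrow> 'v set" where
  "set_mult S T = span {mult x y | x y. x \<in> S \<and> y \<in> T}"

text \<open>Powers are indexed from 1; the value at index 0 is a dummy, excluded in \<open>nilpotent\<close>.\<close>

fun alg_power :: "'v set \<Rightarrow> nat \<Rightarrow> 'v set" where
  "alg_power B 0 = B"
| "alg_power B (Suc 0) = B"
| "alg_power B (Suc (Suc n)) = set_mult B (alg_power B (Suc n))"

definition nilpotent :: "'v set \<Rightarrow> bool" where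
  "nilpotent B \<longleftrightarrow> (\<exists>m\<ge>1. alg_power B m = {0})"

definition maximal_nilpotent_ideal :: "'v set \<Rightarrow> bool" where
  "maximal_nilpotent_ideal N \<longleftrightarrow>
     ideal_of N UNIV \<and> nilpotent N \<and>
     (\<forall>I. ideal_of I UNIV \<and> nilpotent I \<and> N \<subseteq> I \<longrightarrow> I = N)"

text \<open>The description is proper: by finite dimension a maximal nilpotent ideal exists, and it is
  unique because the sum of two nilpotent ideals is a nilpotent ideal.\<close>

definition nilrad :: "'v set" where
  "nilrad = (THE N. maximal_nilpotent_ideal N)"

text \<open>The inclusions in the chain need not be strict, and \<open>t = 0\<close> (the whole algebra)
  is allowed.\<close>

definition subinvariant :: "'v set \<Rightarrow> bool" where
  "subinvariant B \<longleftrightarrow>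
     (\<exists>t. \<exists>C :: nat \<Rightarrow> 'v set. C 0 = UNIV \<and> C t = B \<and>
        (\<forall>i\<le>t. subalgebra (C i)) \<and>
        (\<forall>i. 1 \<le> i \<and> i \<le> t \<longrightarrow> ideal_of (C i) (C (i - 1))))"

end

end

theory Submission
  imports Defs
begin

text \<open>By induction along the chain it suffices that a maximal nilpotent ideal \<open>N\<close> of an ideal \<open>I\<close> of
  \<open>J\<close> is an ideal of \<open>J\<close>. Left multiplication by \<open>a \<in> J\<close> is a derivation \<open>D\<close> of \<open>I\<close>, and in
  characteristic zero \<open>N + D N\<close> is again a nilpotent ideal of \<open>I\<close>: if all products
  \<open>L\<^bsub>x\<^esub> \<dots> L\<^bsub>z\<^esub>\<close> of \<open>k\<close> left multiplications by elements of \<open>N\<close> vanish on \<open>I\<close>, so does the \<open>k\<close>-fold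
  commutator of \<open>D\<close> with such a product, and this commutator is \<open>k!\<close> times
  \<open>L\<^bsub>D x\<^esub> \<dots> L\<^bsub>D z\<^esub>\<close> up to terms containing a factor from \<open>N\<close>. Hence \<open>a n \<in> N\<close> for \<open>n \<in> N\<close>. Right
  multiplication reduces to this, since \<open>a n + n a\<close> lies in the ideal of those elements of \<open>I\<close> that
  annihilate \<open>I\<close> from the left; this ideal has square zero and is therefore contained in \<open>N\<close>.\<close>

section \<open>Products of left multiplications\<close>

context leibniz_algebra
begin

section \<open>Bilinearity and the Leibniz identity\<close>

lemma mult_add_right: "mult x (y + z) = mult x y + mult x z"
  using linear_mult_right[of x] by (simp add: Vector_Spaces.linear_iff)

lemma mult_add_left: "mult (x + y) z = mult x z + mult y z"
  using linear_mult_left[of z] by (simp add: Vector_Spaces.linear_iff)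

lemma mult_scale_right: "mult x (scale c y) = scale c (mult x y)"
  using linear_mult_right[of x] by (simp add: Vector_Spaces.linear_iff)

lemma mult_scale_left: "mult (scale c x) y = scale c (mult x y)"
  using linear_mult_left[of y] by (simp add: Vector_Spaces.linear_iff)

lemma mult_0_right [simp]: "mult x 0 = 0"
  using mult_add_right[of x 0 0] by simp

lemma mult_0_left [simp]: "mult 0 x = 0"
  using mult_add_left[of 0 0 x] by simp

lemma mult_diff_right: "mult x (y - z) = mult x y - mult x z"
  using mult_add_right[of x "y - z" z] by (simp add: algebra_simps)

lemma mult_span_right:
  assumes "y \<in> span S" "subspace T" "\<And>s. s \<in> S \<Longrightarrow> mult x s \<in> T"
  shows "mult x y \<in> T"
  using assms(1)
proof (induction rule: span_induct_alt)
  case base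
  show ?case using subspace_0[OF assms(2)] by simp
next
  case (step c s z)
  then show ?case
    using assms(2,3) by (simp add: mult_add_right mult_scale_right subspace_add subspace_scale)
qed

text \<open>Left multiplication by \<open>mult x y\<close> is the commutator of those by
  \<open>x\<close> and \<open>y\<close>, hence changes sign when \<open>x\<close> and
  \<open>y\<close> are swapped.\<close>

lemma mult_symmetric_left_zero: "mult (mult x y + mult y x) z = 0"
  using leibniz[of x y z] leibniz[of y x z] by (simp add: mult_add_left)

section \<open>The filtration by words of left multiplications\<close>

text \<open>For an ideal \<open>N\<close> of a subalgebra \<open>I\<close>, the spaces
  \<open>words N I j\<close> form a decreasing filtration of \<open>I\<close>. Explicit lists allow
  words to be cut into blocks and compared letter by letter.\<close>

definition words :: "'v set \<Rightarrow> 'v set \<Rightarrow> nat \<Rightarrow> 'v set" where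
  "words N X j = span {foldr mult zs y | zs y. set zs \<subseteq> N \<and> length zs = j \<and> y \<in> X}"

lemma subspace_words: "subspace (words N X j)"
  by (simp add: words_def)

lemma words_base: "set zs \<subseteq> N \<Longrightarrow> length zs = j \<Longrightarrow> y \<in> X \<Longrightarrow> foldr mult zs y \<in> words N X j"
  unfolding words_def by (rule span_base) blast

lemma words_0: "subspace X \<Longrightarrow> words N X 0 = X"
  by (simp add: words_def)

lemma mult_words:
  assumes "n \<in> N" "w \<in> words N X j"
  shows "mult n w \<in> words N X (Suc j)"
  using assms(2) unfolding words_def[of N X j]
proof (rule mult_span_right[OF _ subspace_words])
  fix s assume "s \<in> {foldr mult zs y | zs y. set zs \<subseteq> N \<and> length zs = j \<and> y \<in> X}"
  then obtain zs y where "s = foldr mult zs y" "set zs \<subseteq> N" "length zs = j" "y \<in> X"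
    by blast
  then show "mult n s \<in> words N X (Suc j)"
    using words_base[of "n # zs" N "Suc j" y X] assms(1) by simp
qed

lemma words_Suc: "words N X (Suc j) = set_mult N (words N X j)"
proof
  show "words N X (Suc j) \<subseteq> set_mult N (words N X j)"
    unfolding words_def[of N X "Suc j"] set_mult_def
  proof (rule span_mono, clarify)
    fix zs :: "'v list" and y
    assume zs: "set zs \<subseteq> N" "length zs = Suc j" and y: "y \<in> X"
    obtain n zs' where "zs = n # zs'"
      using zs(2) by (cases zs) auto
    with zs y show "\<exists>n w. foldr mult zs y = mult n w \<and> n \<in> N \<and> w \<in> words N X j"
      by (intro exI[of _ n] exI[of _ "foldr mult zs' y"]) (auto intro: words_base)
  qed
next
  show "set_mult N (words N X j) \<subseteq> words N X (Suc j)"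
    unfolding set_mult_def by (rule span_minimal) (auto intro: mult_words subspace_words)
qed

text \<open>Powers are numbered from 1, so the one with index \<open>Suc j\<close> has
  \<open>j\<close> left factors acting on \<open>N\<close>.\<close>

lemma alg_power_eq_words: "subspace N \<Longrightarrow> alg_power N (Suc j) = words N N j"
  by (induction j) (simp_all add: words_0 words_Suc)

lemma words_mono: "X \<subseteq> Y \<Longrightarrow> words N X j \<subseteq> words N Y j"
  unfolding words_def by (rule span_mono) blast

text \<open>Acting on \<open>I\<close> instead of \<open>N\<close> costs at most one more letter:
  the innermost letter sends \<open>I\<close> into the ideal \<open>N\<close>.\<close>

lemma nilpotent_iff_words:
  assumes "ideal_of N I" "subspace I"
  shows "nilpotent N \<longleftrightarrow> (\<exists>k. words N I k = {0})"
proof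
  have N: "subspace N" "N \<subseteq> I"
    using assms by (auto simp: ideal_of_def)
  {
    assume "nilpotent N"
    then obtain m where "m \<ge> 1" "alg_power N m = {0}"
      by (auto simp: nilpotent_def)
    then obtain j where j: "words N N j = {0}"
      using alg_power_eq_words[OF N(1)] by (cases m) auto
    have "foldr mult zs y = 0" if "set zs \<subseteq> N" "length zs = Suc j" "y \<in> I" for zs y
    proof -
      obtain z where z: "zs = butlast zs @ [z]"
        using \<open>length zs = Suc j\<close> by (metis append_butlast_last_id length_0_conv nat.distinct(1))
      then have "z \<in> N" "set (butlast zs) \<subseteq> N"
        using that(1) by (metis in_set_conv_decomp subsetD, meson in_set_butlastD subset_iff)
      moreover have "mult z y \<in> N"
        using assms(1) \<open>z \<in> N\<close> that(3) by (auto simp: ideal_of_def)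
      ultimately have "foldr mult (butlast zs) (mult z y) \<in> words N N j"
        using that(2) by (intro words_base) auto
      then show ?thesis
        using z j by (metis foldr.simps(1) foldr_Cons foldr_append comp_apply id_apply singletonD)
    qed
    then have "words N I (Suc j) \<subseteq> {0}"
      unfolding words_def by (intro span_minimal) auto
    then show "\<exists>k. words N I k = {0}"
      using subspace_0[OF subspace_words] by (intro exI[of _ "Suc j"]) blast
  }
  assume "\<exists>k. words N I k = {0}"
  then obtain k where "words N I k = {0}" ..
  then have "words N N k = {0}"
    using words_mono[OF N(2), of N k] subspace_0[OF subspace_words] by blast
  then show "nilpotent N"
    unfolding nilpotent_def using alg_power_eq_words[OF N(1)] by (intro exI[of _ "Suc k"]) simp
qed

text \<open>By the Leibniz identity, \<open>x\<close> moves past a letter \<open>n\<close> at the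
  cost of a word in which \<open>n\<close> is replaced by \<open>mult x n\<close>, again an element
  of \<open>N\<close>.\<close>

lemma mult_words_stable:
  assumes N: "ideal_of N I" and I: "subalgebra I" and x: "x \<in> I" and w: "w \<in> words N I j"
  shows "mult x w \<in> words N I j"
  using w unfolding words_def[of N I j]
proof (rule mult_span_right[OF _ subspace_span])
  fix s assume "s \<in> {foldr mult zs y | zs y. set zs \<subseteq> N \<and> length zs = j \<and> y \<in> I}"
  then obtain zs y where s: "s = foldr mult zs y" "set zs \<subseteq> N" "length zs = j" "y \<in> I"
    by blast
  have "mult x (foldr mult zs y) \<in> words N I (length zs)"
    using s(2)
  proof (induction zs)
    case Nil
    show ?case
      using I x s(4) by (simp add: words_0 subalgebra_def)
  next
    case (Cons n zs)
    then have "mult x n \<in> N"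
      using N x by (auto simp: ideal_of_def)
    then have "mult (mult x n) (foldr mult zs y) \<in> words N I (length (n # zs))"
      using Cons.prems s(4) words_base[of "mult x n # zs" N _ y I] by simp
    moreover have "mult n (mult x (foldr mult zs y)) \<in> words N I (length (n # zs))"
      using Cons mult_words by simp
    ultimately show ?case
      by (simp add: leibniz[of x n] subspace_add[OF subspace_words])
  qed
  then show "mult x s \<in> span {foldr mult zs y | zs y. set zs \<subseteq> N \<and> length zs = j \<and> y \<in> I}"
    using s by (simp add: words_def)
qed

lemma foldr_words_stable:
  assumes "ideal_of N I" "subalgebra I" "set zs \<subseteq> I" "w \<in> words N I j"
  shows "foldr mult zs w \<in> words N I j"
  using assms(3) by (induction zs) (auto intro: mult_words_stable assms)

lemma words_subset:
  assumes "ideal_of N I" "subalgebra I"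
  shows "words N I j \<subseteq> I"
  unfolding words_def
proof (rule span_minimal)
  show I: "subspace I"
    using assms by (simp add: subalgebra_def)
  show "{foldr mult zs y | zs y. set zs \<subseteq> N \<and> length zs = j \<and> y \<in> I} \<subseteq> I"
    using foldr_words_stable[OF assms, of _ _ 0] assms(1) by (auto simp: words_0[OF I] ideal_of_def)
qed

text \<open>Letters are exchanged one at a time. Each exchange costs a word with a letter
  \<open>z - q\<close> in \<open>N\<close>, which raises the filtration level; the other letters lie
  in \<open>I\<close> and do not lower it.\<close>

lemma foldr_words_congruent:
  assumes N: "ideal_of N I" and I: "subalgebra I" and w: "w \<in> words N I j"
    and "list_all2 (\<lambda>z q. q \<in> I \<and> z - q \<in> N) zs qs"
  shows "foldr mult zs w - foldr mult qs w \<in> words N I (Suc j)"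
  using assms(4)
proof (induction rule: list_all2_induct)
  case Nil
  show ?case using subspace_0[OF subspace_words] by simp
next
  case (Cons z zs q qs)
  have sub: "N \<subseteq> I" "subspace I"
    using N I by (auto simp: ideal_of_def subalgebra_def)
  have "z \<in> I" if "q \<in> I" "z - q \<in> N" for z q
    using that sub subspace_add[of I "z - q" q] by auto
  with Cons(2) have "set zs \<subseteq> I"
    by (induction rule: list_all2_induct) auto
  then have "mult (z - q) (foldr mult zs w) \<in> words N I (Suc j)"
    using Cons(1) mult_words foldr_words_stable[OF N I _ w] by blast
  moreover have "mult q (foldr mult zs w - foldr mult qs w) \<in> words N I (Suc j)"
    using Cons(1,3) mult_words_stable[OF N I] by blast
  moreover have "foldr mult (z # zs) w - foldr mult (q # qs) w =
      mult (z - q) (foldr mult zs w) + mult q (foldr mult zs w - foldr mult qs w)"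
    using mult_add_left[of "z - q" q] by (simp add: mult_diff_right)
  ultimately show ?case
    using subspace_add[OF subspace_words] by simp
qed

section \<open>Nilpotency of sums\<close>

text \<open>Up to the next filtration level, letters of the sum may be replaced by their
  \<open>Q\<close>-components, so each block of \<open>k\<close> letters raises the level by one.
  Words of length \<open>k * j\<close> thus map \<open>I\<close> into \<open>words N I j\<close>,
  which is zero for a suitable \<open>j\<close>.\<close>

lemma nilpotent_sum:
  assumes N: "ideal_of N I" and I: "subalgebra I" and nil: "nilpotent N" and Q: "Q \<subseteq> I"
    and K: "ideal_of {n + q | n q. n \<in> N \<and> q \<in> Q} I"
    and step: "\<And>qs j w. \<lbrakk>set qs \<subseteq> Q; length qs = k; w \<in> words N I j\<rbrakk> \<Longrightarrow>
        foldr mult qs w \<in> words N I (Suc j)"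
  shows "nilpotent {n + q | n q. n \<in> N \<and> q \<in> Q}"
proof -
  define K where "K = {n + q | n q. n \<in> N \<and> q \<in> Q}"
  have I': "subspace I"
    using I by (simp add: subalgebra_def)
  have step': "foldr mult zs w \<in> words N I (Suc j)"
    if zs: "set zs \<subseteq> K" "length zs = k" and w: "w \<in> words N I j" for zs w j
  proof -
    have "\<forall>z\<in>K. \<exists>q. q \<in> Q \<and> z - q \<in> N"
      unfolding K_def by force
    from bchoice[OF this] obtain f where f: "\<forall>z\<in>K. f z \<in> Q \<and> z - f z \<in> N" ..
    have "list_all2 (\<lambda>z q. q \<in> I \<and> z - q \<in> N) zs (map f zs)"
      using zs(1) f Q by (auto simp: list_all2_conv_all_nth dest!: nth_mem)
    then have "foldr mult zs w - foldr mult (map f zs) w \<in> words N I (Suc j)"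
      by (rule foldr_words_congruent[OF N I w])
    moreover have "foldr mult (map f zs) w \<in> words N I (Suc j)"
      using zs f w by (intro step) auto
    ultimately show ?thesis
      using subspace_add[OF subspace_words] by fastforce
  qed
  have "foldr mult zs y \<in> words N I j"
    if "set zs \<subseteq> K" "length zs = k * j" "y \<in> I" for zs y j
    using that
  proof (induction j arbitrary: zs)
    case 0
    then show ?case using I' by (simp add: words_0)
  next
    case (Suc j)
    have "foldr mult (drop k zs) y \<in> words N I j"
      using Suc.prems set_drop_subset[of k zs] by (intro Suc.IH) auto
    then have "foldr mult (take k zs) (foldr mult (drop k zs) y) \<in> words N I (Suc j)"
      using Suc.prems set_take_subset[of k zs] by (intro step') auto
    then show ?case
      by (metis append_take_drop_id comp_apply foldr_append)
  qed
  then have "words K I (k * j) \<subseteq> words N I j" for j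
    unfolding words_def[of K] by (intro span_minimal) (auto simp: subspace_words)
  moreover obtain j where "words N I j = {0}"
    using nil nilpotent_iff_words[OF N I'] by blast
  ultimately have "words K I (k * j) = {0}"
    using subspace_0[OF subspace_words] by blast
  then show ?thesis
    using nilpotent_iff_words[OF K I'] unfolding K_def by blast
qed

lemma ideal_of_sum:
  assumes "ideal_of N I" "ideal_of P I" "subspace I"
  shows "ideal_of {n + p | n p. n \<in> N \<and> p \<in> P} I"
  unfolding ideal_of_def
proof (intro conjI ballI)
  show "subspace {n + p | n p. n \<in> N \<and> p \<in> P}"
    using assms by (intro subspace_sums) (auto simp: ideal_of_def)
  show "{n + p | n p. n \<in> N \<and> p \<in> P} \<subseteq> I"
    using assms by (auto simp: ideal_of_def intro!: subspace_add)
next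
  fix x y assume "x \<in> {n + p | n p. n \<in> N \<and> p \<in> P}" and y: "y \<in> I"
  then obtain n p where x: "x = n + p" "n \<in> N" "p \<in> P"
    by blast
  have "mult n y \<in> N" "mult p y \<in> P" "mult y n \<in> N" "mult y p \<in> P"
    using assms x y by (auto simp: ideal_of_def)
  then show "mult x y \<in> {n + p | n p. n \<in> N \<and> p \<in> P}" "mult y x \<in> {n + p | n p. n \<in> N \<and> p \<in> P}"
    unfolding x(1) mult_add_left mult_add_right by blast+
qed

text \<open>Words of some length \<open>k\<close> in \<open>P\<close> vanish on \<open>I\<close>
  altogether, so they trivially raise the filtration level.\<close>

lemma nilpotent_sum_ideals:
  assumes N: "ideal_of N I" and P: "ideal_of P I" and I: "subalgebra I"
    and nil: "nilpotent N" "nilpotent P"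
  shows "nilpotent {n + p | n p. n \<in> N \<and> p \<in> P}"
proof -
  have I': "subspace I"
    using I by (simp add: subalgebra_def)
  obtain k where k: "words P I k = {0}"
    using nil(2) nilpotent_iff_words[OF P I'] by blast
  show ?thesis
  proof (rule nilpotent_sum[OF N I nil(1), of P k])
    fix qs j w assume qs: "set qs \<subseteq> P" "length qs = k" and w: "w \<in> words N I j"
    have "w \<in> I"
      using w words_subset[OF N I] by blast
    then have "foldr mult qs w = 0"
      using words_base[OF qs] k by blast
    then show "foldr mult qs w \<in> words N I (Suc j)"
      using subspace_0[OF subspace_words] by simp
  next
    show "P \<subseteq> I"
      using P by (simp add: ideal_of_def)
    show "ideal_of {n + p | n p. n \<in> N \<and> p \<in> P} I"
      by (rule ideal_of_sum[OF N P I'])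
  qed
qed

section \<open>Maximal nilpotent ideals\<close>

definition maximal_nilpotent_ideal_of :: "'v set \<Rightarrow> 'v set \<Rightarrow> bool" where
  "maximal_nilpotent_ideal_of N I \<longleftrightarrow> ideal_of N I \<and> nilpotent N \<and>
     (\<forall>P. ideal_of P I \<and> nilpotent P \<and> N \<subseteq> P \<longrightarrow> P = N)"

text \<open>The sum of \<open>N\<close> and \<open>P\<close> is a nilpotent ideal containing
  \<open>N\<close>, so maximality makes it equal to \<open>N\<close>.\<close>

lemma maximal_nilpotent_ideal_of_contains:
  assumes max: "maximal_nilpotent_ideal_of N I" and I: "subalgebra I"
    and P: "ideal_of P I" "nilpotent P"
  shows "P \<subseteq> N"
proof -
  define K where "K = {n + p | n p. n \<in> N \<and> p \<in> P}"
  have N: "ideal_of N I" "nilpotent N"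
    using max by (auto simp: maximal_nilpotent_ideal_of_def)
  have 0: "0 \<in> N" "0 \<in> P"
    using N P by (auto simp: ideal_of_def subspace_0)
  have "N \<subseteq> K" "P \<subseteq> K"
    using 0 unfolding K_def by force+
  moreover have "ideal_of K I" "nilpotent K"
    unfolding K_def using N P I by (simp_all add: ideal_of_sum nilpotent_sum_ideals subalgebra_def[of I])
  ultimately show ?thesis
    using max unfolding maximal_nilpotent_ideal_of_def by blast
qed

text \<open>Among the nilpotent ideals containing \<open>N\<close>, one of largest dimension is
  maximal.\<close>

lemma maximal_nilpotent_ideal_of_exists:
  assumes "ideal_of N I" "nilpotent N"
  obtains N' where "maximal_nilpotent_ideal_of N' I" "N \<subseteq> N'"
proof -
  obtain B where B: "finite B" "span B = UNIV"
    using finite_dim by blast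
  \<comment> \<open>A basis inside the finite spanning set gives access to dimension theory.\<close>
  obtain B' where B': "B' \<subseteq> B" "independent B'" "span B' = UNIV"
    using B maximal_independent_subset[of B] span_mono by (metis span_span top.extremum_uniqueI)
  interpret finite_dimensional_vector_space scale B'
    using B B' by unfold_locales (auto intro: finite_subset)
  let ?P = "\<lambda>P. ideal_of P I \<and> nilpotent P \<and> N \<subseteq> P"
  have "\<forall>P. ?P P \<longrightarrow> dim P < Suc (dim (UNIV :: 'v set))"
    using dim_subset[OF subset_UNIV] by (metis le_imp_less_Suc)
  then obtain N' where N': "?P N'" "\<And>P. ?P P \<Longrightarrow> dim P \<le> dim N'"
    using ex_has_greatest_nat[of ?P N dim "Suc (dim UNIV)"] assms by (metis (no_types, lifting) subset_refl)
  have "P = N'" if "?P P" "N' \<subseteq> P" for P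
    using that N' subspace_dim_equal[of N' P] by (auto simp: ideal_of_def)
  then show thesis
    using N'(1) that[of N'] by (auto simp: maximal_nilpotent_ideal_of_def)
qed

lemma maximal_nilpotent_ideal_of_UNIV:
  "maximal_nilpotent_ideal_of N UNIV \<longleftrightarrow> maximal_nilpotent_ideal N"
  by (simp add: maximal_nilpotent_ideal_of_def maximal_nilpotent_ideal_def)

text \<open>Two maximal nilpotent ideals contain each other, so the definite description in
  \<open>nilrad\<close> is proper.\<close>

lemma subset_nilrad:
  assumes "ideal_of N UNIV" "nilpotent N"
  shows "N \<subseteq> nilrad"
proof -
  have UNIV: "subalgebra UNIV"
    by (simp add: subalgebra_def)
  obtain R where R: "maximal_nilpotent_ideal_of R UNIV"
    using maximal_nilpotent_ideal_of_exists[OF assms] by blast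
  have "nilrad = R"
    unfolding nilrad_def
  proof (rule the_equality)
    show "maximal_nilpotent_ideal R"
      using R by (simp add: maximal_nilpotent_ideal_of_UNIV)
    show "R' = R" if "maximal_nilpotent_ideal R'" for R'
      using R that maximal_nilpotent_ideal_of_contains[OF _ UNIV]
      unfolding maximal_nilpotent_ideal_of_UNIV[symmetric]
      by (meson maximal_nilpotent_ideal_of_def subset_antisym)
  qed
  then show ?thesis
    using maximal_nilpotent_ideal_of_contains[OF R UNIV assms] by simp
qed

end

section \<open>Derivations in characteristic zero\<close>

locale leibniz_algebra_char_0 = leibniz_algebra scale mult
  for scale :: "'f::field_char_0 \<Rightarrow> 'v::ab_group_add \<Rightarrow> 'v" and mult
begin

text \<open>\<open>taylor D xs m\<close> is the coefficient of \<open>t\<^sup>m\<close> in the product of the left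
  multiplications by \<open>exp(t D) x\<close>, where \<open>x\<close> ranges over \<open>xs\<close>.\<close>

primrec taylor :: "('v \<Rightarrow> 'v) \<Rightarrow> 'v list \<Rightarrow> nat \<Rightarrow> 'v \<Rightarrow> 'v" where
  "taylor D [] m y = (if m = 0 then y else 0)"
| "taylor D (x # xs) m y =
     (\<Sum>i\<le>m. scale (1 / fact i) (mult ((D ^^ i) x) (taylor D xs (m - i) y)))"

lemma taylor_0 [simp]: "taylor D xs 0 y = foldr mult xs y"
  by (induction xs) simp_all

definition derivation :: "('v \<Rightarrow> 'v) \<Rightarrow> bool" where
  "derivation D \<longleftrightarrow> Vector_Spaces.linear scale scale D \<and>
     (\<forall>x y. D (mult x y) = mult (D x) y + mult x (D y))"

lemma derivation_mult_left: "derivation (mult a)"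
  unfolding derivation_def using linear_mult_right leibniz by blast

text \<open>The coefficients of the differential equation \<open>T'(t) = D T(t) - T(t) D\<close>.\<close>

lemma taylor_Suc:
  assumes "derivation D"
  shows "scale (of_nat (Suc m)) (taylor D xs (Suc m) y) = D (taylor D xs m y) - taylor D xs m (D y)"
proof (induction xs arbitrary: m)
  interpret D: Vector_Spaces.linear scale scale D
    using assms by (simp add: derivation_def)
  have Dm: "D (mult x y) = mult (D x) y + mult x (D y)" for x y
    using assms by (simp add: derivation_def)
  {
    case Nil
    show ?case by (simp add: D.zero)
  }
  case (Cons x xs m)
  define L where "L i = mult ((D ^^ i) x)" for i
  have "scale (of_nat (Suc m)) (taylor D (x # xs) (Suc m) y) =
      (\<Sum>i\<le>Suc m. scale (of_nat (Suc m) / fact i) (L i (taylor D xs (Suc m - i) y)))"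
    by (simp add: scale_sum_right L_def del: sum.atMost_Suc of_nat_Suc)
  \<comment> \<open>Product rule: \<open>Suc m\<close> is split as \<open>i + (Suc m - i)\<close>.
    The first part accounts for differentiating the letter \<open>x\<close>, the second for
    differentiating the rest of the word.\<close>
  also have "\<dots> = (\<Sum>i\<le>Suc m. scale (of_nat i / fact i) (L i (taylor D xs (Suc m - i) y))) +
      (\<Sum>i\<le>Suc m. scale (of_nat (Suc m - i) / fact i) (L i (taylor D xs (Suc m - i) y)))"
    unfolding sum.distrib[symmetric]
    by (intro sum.cong refl)
      (simp add: scale_left_distrib[symmetric] add_divide_distrib[symmetric] of_nat_diff del: of_nat_Suc)
  \<comment> \<open>The term \<open>i = 0\<close> vanishes; in the others, \<open>i / fact i\<close>
    is \<open>1 / fact (i - 1)\<close>.\<close>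
  also have "(\<Sum>i\<le>Suc m. scale (of_nat i / fact i) (L i (taylor D xs (Suc m - i) y))) =
      (\<Sum>i\<le>m. scale (1 / fact i) (L (Suc i) (taylor D xs (m - i) y)))"
    by (subst sum.atMost_Suc_shift) (simp add: divide_simps del: of_nat_Suc)
  \<comment> \<open>The term \<open>i = Suc m\<close> vanishes; the others take the form to which
    the induction hypothesis applies.\<close>
  also have "(\<Sum>i\<le>Suc m. scale (of_nat (Suc m - i) / fact i) (L i (taylor D xs (Suc m - i) y))) =
      (\<Sum>i\<le>m. scale (1 / fact i) (L i (scale (of_nat (Suc (m - i))) (taylor D xs (Suc (m - i)) y))))"
    by (simp add: L_def mult_scale_right Suc_diff_le del: of_nat_Suc of_nat_diff)
  also have "\<dots> = (\<Sum>i\<le>m. scale (1 / fact i) (L i (D (taylor D xs (m - i) y)))) -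
      (\<Sum>i\<le>m. scale (1 / fact i) (L i (taylor D xs (m - i) (D y))))"
    by (simp only: Cons.IH) (simp add: L_def mult_diff_right scale_right_diff_distrib sum_subtractf)
  \<comment> \<open>Since \<open>D (L i u) = L (Suc i) u + L i (D u)\<close>, the first two sums
    merge into \<open>D\<close> of the coefficient.\<close>
  also have "(\<Sum>i\<le>m. scale (1 / fact i) (L (Suc i) (taylor D xs (m - i) y))) +
      ((\<Sum>i\<le>m. scale (1 / fact i) (L i (D (taylor D xs (m - i) y)))) -
      (\<Sum>i\<le>m. scale (1 / fact i) (L i (taylor D xs (m - i) (D y))))) =
      D (taylor D (x # xs) m y) - taylor D (x # xs) m (D y)"
    by (simp add: L_def D.sum D.scale Dm scale_right_distrib sum.distrib)
  finally show ?case .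
qed

text \<open>In the recursion \<open>taylor_Suc\<close> both terms on the right vanish by induction,
  because \<open>D\<close> preserves \<open>I\<close>; the factor \<open>Suc m\<close> cancels in
  characteristic zero.\<close>

lemma taylor_eq_0:
  assumes D: "derivation D" and I: "\<And>y. y \<in> I \<Longrightarrow> D y \<in> I"
    and zero: "\<And>y. y \<in> I \<Longrightarrow> foldr mult xs y = 0" and y: "y \<in> I"
  shows "taylor D xs m y = 0"
  using y
proof (induction m arbitrary: y)
  case 0
  then show ?case by (simp add: zero)
next
  case (Suc m)
  have "D 0 = 0"
    using D by (auto simp: derivation_def dest: Vector_Spaces.linear.axioms module_hom.zero)
  then have "scale (of_nat (Suc m)) (taylor D xs (Suc m) y) = 0"
    using Suc I by (simp add: taylor_Suc[OF D] del: of_nat_Suc)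
  then show ?case
    by (simp del: of_nat_Suc)
qed

section \<open>Adjoining the image of a derivation to a nilpotent ideal\<close>

context
  fixes N I D
  assumes N: "ideal_of N I" and I: "subalgebra I" and D: "derivation D"
    and DI: "\<And>y. y \<in> I \<Longrightarrow> D y \<in> I"
begin

lemma N_subset: "N \<subseteq> I" and subspace_N: "subspace N" and subspace_I: "subspace I"
  using N I by (auto simp: ideal_of_def subalgebra_def)

lemma funpow_D_mem: "x \<in> I \<Longrightarrow> (D ^^ i) x \<in> I"
  by (induction i) (simp_all add: DI)

lemma taylor_mem:
  assumes "set xs \<subseteq> I" "y \<in> words N I j"
  shows "taylor D xs m y \<in> words N I j"
  using assms(1)
proof (induction xs arbitrary: m)
  case Nil
  show ?case using assms(2) subspace_0[OF subspace_words] by simp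
next
  case (Cons x xs)
  then show ?case
    unfolding taylor.simps
    by (intro subspace_sum subspace_scale subspace_words mult_words_stable[OF N I] funpow_D_mem
        Cons.IH) auto
qed

text \<open>With fewer derivatives than letters, every term keeps an undifferentiated letter, which
  lies in \<open>N\<close>.\<close>

lemma taylor_mem_Suc:
  assumes "set xs \<subseteq> N" "y \<in> words N I j" "m < length xs"
  shows "taylor D xs m y \<in> words N I (Suc j)"
  using assms
proof (induction xs arbitrary: m)
  case (Cons x xs)
  have "mult ((D ^^ i) x) (taylor D xs (m - i) y) \<in> words N I (Suc j)" if "i \<le> m" for i
  proof (cases i)
    case 0
    then show ?thesis
      using Cons.prems N_subset by (auto intro!: mult_words taylor_mem)
  next
    case (Suc i')
    then show ?thesis
      using Cons that N_subset by (intro mult_words_stable[OF N I] funpow_D_mem Cons.IH) auto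
  qed
  then show ?case
    by (auto intro!: subspace_sum subspace_scale subspace_words)
qed simp

text \<open>With as many derivatives as letters, either each letter is differentiated exactly once,
  with coefficient 1, or some letter from \<open>N\<close> is left untouched.\<close>

lemma taylor_leading_term:
  assumes "set xs \<subseteq> N" "y \<in> words N I j"
  shows "taylor D xs (length xs) y - foldr mult (map D xs) y \<in> words N I (Suc j)"
  using assms
proof (induction xs)
  case Nil
  show ?case by (simp add: subspace_0[OF subspace_words])
next
  case (Cons x xs)
  \<comment> \<open>\<open>f i\<close> collects the terms with \<open>i\<close> derivatives on
    \<open>x\<close>: \<open>i = 0\<close> leaves \<open>x\<close> itself in front,
    \<open>i = 1\<close> is handled by the induction hypothesis, and \<open>i \<ge> 2\<close> leaves
    fewer derivatives than letters for \<open>xs\<close>.\<close>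
  define f where
    "f = (\<lambda>i. scale (1 / fact i) (mult ((D ^^ i) x) (taylor D xs (Suc (length xs) - i) y)))"
  have x: "x \<in> N" "x \<in> I" "set xs \<subseteq> N" "set xs \<subseteq> I"
    using Cons.prems N_subset by auto
  have f0: "f 0 \<in> words N I (Suc j)"
    using x Cons.prems by (auto simp: f_def simp del: taylor.simps intro!: mult_words taylor_mem)
  have f1: "f 1 - foldr mult (map D (x # xs)) y \<in> words N I (Suc j)"
    using mult_words_stable[OF N I DI[OF x(2)] Cons.IH] x Cons.prems
    by (simp add: f_def mult_diff_right)
  have f2: "f i \<in> words N I (Suc j)" if "i \<in> {2..Suc (length xs)}" for i
    using x Cons.prems that unfolding f_def
    by (intro subspace_scale[OF subspace_words] mult_words_stable[OF N I] funpow_D_mem taylor_mem_Suc) auto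
  have "taylor D (x # xs) (length (x # xs)) y = sum f {..Suc (length xs)}"
    by (simp only: taylor.simps f_def length_Cons)
  also have "{..Suc (length xs)} = insert 0 (insert 1 {2..Suc (length xs)})"
    by auto
  also have "sum f \<dots> = f 0 + (f 1 + sum f {2..Suc (length xs)})"
    by (simp del: sum.cl_ivl_Suc)
  finally have "taylor D (x # xs) (length (x # xs)) y - foldr mult (map D (x # xs)) y =
      f 0 + ((f 1 - foldr mult (map D (x # xs)) y) + sum f {2..Suc (length xs)})"
    by (simp only: add_diff_eq diff_add_eq)
  also have "\<dots> \<in> words N I (Suc j)"
    by (intro subspace_add subspace_words subspace_sum f0 f1 f2)
  finally show ?case .
qed

text \<open>The product rule gives \<open>mult (D n') y = D (mult n' y) - mult n' (D y)\<close> with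
  both products in \<open>N\<close>, and likewise on the other side.\<close>

lemma ideal_of_sum_derivation: "ideal_of {n + q | n q. n \<in> N \<and> q \<in> D ` N} I"
proof -
  interpret D: Vector_Spaces.linear scale scale D
    using D by (simp add: derivation_def)
  have Dm: "D (mult x y) = mult (D x) y + mult x (D y)" for x y
    using D by (simp add: derivation_def)
  let ?K = "{n + q | n q. n \<in> N \<and> q \<in> D ` N}"
  show ?thesis
    unfolding ideal_of_def
  proof (intro conjI ballI)
    show "subspace ?K"
      by (intro subspace_sums subspace_N D.subspace_image)
    show "?K \<subseteq> I"
      using N_subset DI by (auto intro!: subspace_add[OF subspace_I])
  next
    fix x y assume "x \<in> ?K" and y: "y \<in> I"
    then obtain n n' where x: "x = n + D n'" "n \<in> N" "n' \<in> N"
      by auto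
    have mem: "mult n y \<in> N" "mult y n \<in> N" "mult n' y \<in> N" "mult y n' \<in> N"
        "mult n' (D y) \<in> N" "mult (D y) n' \<in> N"
      using N x y DI[OF y] by (auto simp: ideal_of_def)
    have "mult x y = (mult n y - mult n' (D y)) + D (mult n' y)"
      by (simp add: x Dm mult_add_left)
    then show "mult x y \<in> ?K"
      using mem subspace_diff[OF subspace_N] by blast
    have "mult y x = (mult y n - mult (D y) n') + D (mult y n')"
      by (simp add: x Dm mult_add_right)
    then show "mult y x \<in> ?K"
      using mem subspace_diff[OF subspace_N] by blast
  qed
qed

text \<open>If all words of length \<open>k\<close> in \<open>N\<close> vanish on \<open>I\<close>,
  so do their Taylor coefficients of order \<open>k\<close>, whose leading terms are the words
  \<open>map D xs\<close>. Such words therefore raise the filtration level.\<close>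

lemma nilpotent_sum_derivation:
  assumes "nilpotent N"
  shows "nilpotent {n + q | n q. n \<in> N \<and> q \<in> D ` N}"
proof -
  obtain k where k: "words N I k = {0}"
    using assms nilpotent_iff_words[OF N subspace_I] by blast
  show ?thesis
  proof (rule nilpotent_sum[OF N I assms _ ideal_of_sum_derivation, of k])
    show "D ` N \<subseteq> I"
      using N_subset DI by auto
    fix qs j w assume qs: "set qs \<subseteq> D ` N" "length qs = k" and w: "w \<in> words N I j"
    have "qs \<in> map D ` lists N"
      using qs(1) by (simp add: lists_image[symmetric] in_lists_conv_set subset_iff)
    then obtain xs where xs: "qs = map D xs" "set xs \<subseteq> N"
      by auto
    have "foldr mult xs y = 0" if "y \<in> I" for y
      using words_base[of xs N k y I] qs xs that k by simp
    then have "taylor D xs k w = 0"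
      using w words_subset[OF N I] by (intro taylor_eq_0[OF D, of I]) (auto intro: DI)
    then have "- foldr mult qs w \<in> words N I (Suc j)"
      using taylor_leading_term[OF xs(2) w] qs(2) xs(1) by simp
    then show "foldr mult qs w \<in> words N I (Suc j)"
      using subspace_neg[OF subspace_words] by fastforce
  qed
qed

lemma derivation_maximal_nilpotent_ideal:
  assumes "maximal_nilpotent_ideal_of N I" "n \<in> N"
  shows "D n \<in> N"
proof -
  have "{n + q | n q. n \<in> N \<and> q \<in> D ` N} \<subseteq> N"
    using maximal_nilpotent_ideal_of_contains[OF assms(1) I ideal_of_sum_derivation]
      nilpotent_sum_derivation assms(1) by (simp add: maximal_nilpotent_ideal_of_def)
  moreover have "0 + D n \<in> {n + q | n q. n \<in> N \<and> q \<in> D ` N}"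
    using assms(2) subspace_0[OF subspace_N] by blast
  ultimately show ?thesis by auto
qed

end

section \<open>Descent along the chain\<close>

lemma left_annihilator_ideal:
  assumes I: "subalgebra I"
  defines "Z \<equiv> {z \<in> I. \<forall>y\<in>I. mult z y = 0}"
  shows "ideal_of Z I" "nilpotent Z"
proof -
  have I': "subspace I" "\<And>x y. x \<in> I \<Longrightarrow> y \<in> I \<Longrightarrow> mult x y \<in> I"
    using I by (auto simp: subalgebra_def)
  show "ideal_of Z I"
    unfolding ideal_of_def
  proof (intro conjI ballI)
    show "subspace Z"
      using I'(1) by (auto simp: Z_def subspace_def mult_add_left mult_scale_left)
    show "Z \<subseteq> I"
      by (auto simp: Z_def)
  next
    fix z y assume z: "z \<in> Z" and y: "y \<in> I"
    show "mult z y \<in> Z"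
      using z y subspace_0[OF I'(1)] by (simp add: Z_def)
    \<comment> \<open>Here \<open>(y z) w = y (z w) - z (y w)\<close>, and \<open>z\<close>
      annihilates both \<open>w\<close> and \<open>y w\<close>.\<close>
    have "mult (mult y z) w = 0" if "w \<in> I" for w
      using leibniz[of y z w] z y that I'(2) by (simp add: Z_def)
    then show "mult y z \<in> Z"
      using z y I'(2) by (simp add: Z_def)
  qed
  have "set_mult Z Z \<subseteq> {0}"
    unfolding set_mult_def by (rule span_minimal) (auto simp: Z_def)
  then have "alg_power Z 2 = {0}"
    using span_zero by (auto simp: numeral_2_eq_2 set_mult_def)
  then show "nilpotent Z"
    unfolding nilpotent_def by (intro exI[of _ 2]) simp
qed

lemma maximal_nilpotent_ideal_of_ideal:
  assumes max: "maximal_nilpotent_ideal_of N I" and I: "subalgebra I" and J: "ideal_of I J"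
  shows "ideal_of N J"
  unfolding ideal_of_def
proof (intro conjI ballI)
  have N: "ideal_of N I"
    using max by (simp add: maximal_nilpotent_ideal_of_def)
  show N': "subspace N" and "N \<subseteq> J"
    using N J by (auto simp: ideal_of_def)
  fix n a assume n: "n \<in> N" and a: "a \<in> J"
  show left: "mult a n \<in> N"
    using J a by (intro derivation_maximal_nilpotent_ideal[OF N I derivation_mult_left _ max n])
      (auto simp: ideal_of_def)
  have "n \<in> I"
    using N n by (auto simp: ideal_of_def)
  \<comment> \<open>Although \<open>a\<close> lies only in \<open>J\<close>, both products are in
    \<open>I\<close> because \<open>n\<close> is; the sum thus belongs to the left annihilator of
    \<open>I\<close>.\<close>
  then have "mult n a + mult a n \<in> I"
    using J a I by (auto simp: ideal_of_def subalgebra_def intro: subspace_add)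
  then have "mult n a + mult a n \<in> N"
    using maximal_nilpotent_ideal_of_contains[OF max I left_annihilator_ideal[OF I]]
    by (auto simp: mult_symmetric_left_zero)
  then show "mult n a \<in> N"
    using subspace_diff[OF N' _ left] by fastforce
qed

lemma nilpotent_subinvariant_subset_nilrad:
  assumes "nilpotent M" "subinvariant M"
  shows "M \<subseteq> nilrad"
  using assms(2) unfolding subinvariant_def
proof (elim exE)
  fix t :: nat and C
  assume C: "C 0 = UNIV \<and> C t = M \<and> (\<forall>i\<le>t. subalgebra (C i)) \<and>
      (\<forall>i. 1 \<le> i \<and> i \<le> t \<longrightarrow> ideal_of (C i) (C (i - 1)))"
  have sub: "subalgebra (C i)" if "i \<le> t" for i
    using C that by simp
  have ideal: "ideal_of (C (Suc i)) (C i)" if "i < t" for i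
    using C[THEN conjunct2, THEN conjunct2, THEN conjunct2, rule_format, of "Suc i"] that by simp
  \<comment> \<open>Downward induction from \<open>C t = M\<close>. Before each step the ideal is
    enlarged to a maximal nilpotent one, since it is for these that the ideal property passes from
    \<open>C (Suc i)\<close> to \<open>C i\<close>.\<close>
  have "\<exists>N. ideal_of N (C i) \<and> nilpotent N \<and> M \<subseteq> N" if "i \<le> t" for i
    using that
  proof (induction rule: inc_induct)
    case base
    have "ideal_of M (C t)"
      using sub[of t] C by (auto simp: ideal_of_def subalgebra_def)
    then show ?case
      using assms(1) by blast
  next
    case (step i)
    then obtain N' where N': "ideal_of N' (C (Suc i))" "nilpotent N'" "M \<subseteq> N'"
      by blast
    from N'(1,2) obtain N where N: "maximal_nilpotent_ideal_of N (C (Suc i))" "N' \<subseteq> N"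
      by (rule maximal_nilpotent_ideal_of_exists)
    then have "ideal_of N (C i)"
      using maximal_nilpotent_ideal_of_ideal sub[of "Suc i"] ideal[of i] step.hyps by simp
    then show ?case
      using N N'(3) by (auto simp: maximal_nilpotent_ideal_of_def)
  qed
  from this[of 0] obtain N where "ideal_of N UNIV" "nilpotent N" "M \<subseteq> N"
    using C by auto
  then show ?thesis
    using subset_nilrad by blast
qed

end

theorem theorem3p9:
  fixes scale :: "'f::field_char_0 \<Rightarrow> 'v::ab_group_add \<Rightarrow> 'v"
    and mult :: "'v \<Rightarrow> 'v \<Rightarrow> 'v"
    and M :: "'v set"
  assumes "leibniz_algebra scale mult"
    and "leibniz_algebra.subalgebra scale mult M"
    and "leibniz_algebra.nilpotent scale mult M"
    and "leibniz_algebra.subinvariant scale mult M"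
  shows "M \<subseteq> leibniz_algebra.nilrad scale mult"
proof -
  interpret leibniz_algebra_char_0 scale mult
    using assms(1) by (simp add: leibniz_algebra_char_0_def)
  show ?thesis
    using assms(3,4) by (rule nilpotent_subinvariant_subset_nilrad)
qed

end
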